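(* There exist a metric graph $\Gamma$, a point $q\in\Gamma$, a divisor $D$ on $\Gamma$ with $D(p)\ge 0$ for all $p\in\Gamma$ with $p\ne q$, and a greedy reduction of $D$ with respect to $q$ which does not terminate after a finite number of steps; that is, there is an infinite sequence of divisors $D=D_0,D_1,D_2,\dots$ such that for every $i\ge 1$ one has $D_i=D_{i-1}-Q(f_{i-1})$, where $f_{i-1}$ is a maximal legal firing towards $q$ for $D_{i-1}$.
   Context: A metric graph $\Gamma$ is a compact connected metric space obtained from a finite edge-weighted graph by viewing each edge of weight $w>0$ as a segment of length $w$ (with the path metric). The degree of a point $p\in\Gamma$ is the number of tangent directions at $p$; a combinatorial vertex is a point of degree other than $2$. A divisor $D$ on $\Gamma$ is a formal integer combination of points of $\Gamma$ with finitely many nonzero coefficients; $D(p)$ is the coefficient (number of chips) at $p$. Fix $q\in\Gamma$. A (basic) firing $f$ towards $q$ of length $\epsilon=\epsilon(f)>0$ is given by two disjoint nonempty connected closed subsets $X,Y\subset\Gamma$ with $q\in X$ such that $Z=\Gamma\setminus(X\cup Y)$ is a disjoint union of finitely many open segments of length $\epsilon$, each having one endpoint in $X$ and the other endpoint in $Y$. The associated function $f:\Gamma\to\mathbb{R}$ is the piecewise affine function equal to $0$ on $X$, equal to $\epsilon$ on $Y$, and of slope $1$ on each segment of $Z$ in the direction from $X$ to $Y$. The divisor $Q(f)$ is $\sum_{I}\big((y_I)-(x_I)\big)$, the sum being over the segments $I$ of $Z$, where $x_I\in X$ and $y_I\in Y$ are the endpoints of $I$. Thus passing from $D$ to $D-Q(f)$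 pushes one chip along each segment of the cut $Z$ a distance $\epsilon$ from $Y$ to $X$, i.e. towards $q$. For a divisor $D$ with $D(p)\ge0$ for all $p\neq q$, the firing $f$ is legal for $D$ if $D-Q(f)$ is also nonnegative at all points other than $q$. It is a maximal legal firing for $D$ if it is legal and its length is maximum for the given cut, i.e. there is no legal firing towards $q$ for $D$ with the same set $Y$ and strictly larger length (equivalently, at least one of the pushed chips hits a combinatorial vertex or $q$, and so cannot be pushed further without choosing a different cut). A greedy reduction of $D=D_0$ with respect to $q$ is a sequence of divisors $D_i$ with $D_i=D_{i-1}-Q(f_{i-1})$, where each $f_{i-1}$ is a maximal legal firing towards $q$ for $D_{i-1}$. *)

theory Defs
  imports
    "HOL-Analysis.Analysis"
    "HOL-Library.Poly_Mapping"
    "Graph_Theory.Digraph_Component"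
begin

section \<open>Metric graphs\<close>

text \<open>
  A finite weighted (multi)graph is a finite multi-digraph together with positive arc lengths.
  The direction of an arc only serves to parametrise the corresponding segment from its tail to
  its head; loops and parallel arcs are allowed, and connectedness refers to the underlying
  undirected graph. The qualified name below is needed because the digraph notion and the
  topological notion of connectedness have the same base name.
\<close>

locale metric_graph = fin_digraph G
  for G :: "('v, 'e) pre_digraph" (structure) and w :: "'e \<Rightarrow> real" +
  assumes weight_pos: "e \<in> arcs G \<Longrightarrow> 0 < w e"
    and connected_graph: "Digraph_Component.connected G"

datatype ('v, 'e) gpoint = Vertex 'v | Interior 'e real

definition gpoints :: "('v, 'e) pre_digraph \<Rightarrow> ('e \<Rightarrow> real) \<Rightarrow> ('v, 'e) gpoint set" where
  "gpoints G w = Vertex ` verts G \<union> {Interior e t | e t. e \<in> arcs G \<and> 0 < t \<and> t < w e}"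

text \<open>The point at distance \<open>t \<in> {0..w e}\<close> from the tail on the closed segment of \<open>e\<close>.\<close>

definition edge_point ::
  "('v, 'e) pre_digraph \<Rightarrow> ('e \<Rightarrow> real) \<Rightarrow> 'e \<Rightarrow> real \<Rightarrow> ('v, 'e) gpoint" where
  "edge_point G w e t =
     (if t \<le> 0 then Vertex (tail G e) else if w e \<le> t then Vertex (head G e) else Interior e t)"

text \<open>
  \<open>route G w x l y\<close>: there is a path from \<open>x\<close> to \<open>y\<close> of total length \<open>l\<close> consisting of finitely
  many straight pieces, each of them contained in one closed edge.
\<close>

inductive route ::
  "('v, 'e) pre_digraph \<Rightarrow> ('e \<Rightarrow> real) \<Rightarrow> ('v, 'e) gpoint \<Rightarrow> real \<Rightarrow> ('v, 'e) gpoint \<Rightarrow> bool"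
  for G :: "('v, 'e) pre_digraph" and w :: "'e \<Rightarrow> real" where
  refl: "x \<in> gpoints G w \<Longrightarrow> route G w x 0 x"
| step: "route G w x l (edge_point G w e s) \<Longrightarrow> e \<in> arcs G \<Longrightarrow> s \<in> {0..w e} \<Longrightarrow> t \<in> {0..w e}
    \<Longrightarrow> route G w x (l + \<bar>s - t\<bar>) (edge_point G w e t)"

text \<open>The path metric; the value outside of the space is irrelevant.\<close>

definition path_dist ::
  "('v, 'e) pre_digraph \<Rightarrow> ('e \<Rightarrow> real) \<Rightarrow> ('v, 'e) gpoint \<Rightarrow> ('v, 'e) gpoint \<Rightarrow> real" where
  "path_dist G w x y =
     (if x \<in> gpoints G w \<and> y \<in> gpoints G w then Inf {l. route G w x l y} else 0)"

abbreviation gtopology ::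
  "('v, 'e) pre_digraph \<Rightarrow> ('e \<Rightarrow> real) \<Rightarrow> ('v, 'e) gpoint topology" where
  "gtopology G w \<equiv> Metric_space.mtopology (gpoints G w) (path_dist G w)"

lemma route_nonneg: "route G w x l y \<Longrightarrow> 0 \<le> l"
  by (induction rule: route.induct) auto

lemma route_trans: "route G w y m z \<Longrightarrow> route G w x l y \<Longrightarrow> route G w x (l + m) z"
proof (induction rule: route.induct)
  case (refl x)
  then show ?case by simp
next
  case (step y m e s t)
  from route.step[OF step.IH[OF step.prems] step.hyps(2-4)] show ?case
    by (simp add: add.assoc)
qed

text \<open>A function that is 1-Lipschitz on every edge is 1-Lipschitz for the path metric.\<close>

lemma route_lipschitz:
  assumes "\<And>e s t. e \<in> arcs G \<Longrightarrow> s \<in> {0..w e} \<Longrightarrow> t \<in> {0..w e}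
             \<Longrightarrow> \<bar>h (edge_point G w e s) - h (edge_point G w e t)\<bar> \<le> \<bar>s - t\<bar>"
    and "route G w x l y"
  shows "\<bar>h x - h y :: real\<bar> \<le> l"
  using assms(2)
proof (induction rule: route.induct)
  case (step x l e s t)
  then show ?case using assms(1)[of e s t] by linarith
qed simp

context metric_graph
begin

lemma edge_point_mem: "e \<in> arcs G \<Longrightarrow> edge_point G w e t \<in> gpoints G w"
  by (auto simp: edge_point_def gpoints_def)

lemma route_step1:
  "e \<in> arcs G \<Longrightarrow> s \<in> {0..w e} \<Longrightarrow> t \<in> {0..w e}
    \<Longrightarrow> route G w (edge_point G w e s) \<bar>s - t\<bar> (edge_point G w e t)"
  using route.step[OF route.refl[OF edge_point_mem], of e s t] by simp

lemma route_sym: "route G w x l y \<Longrightarrow> route G w y l x"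
proof (induction rule: route.induct)
  case (step x l e s t)
  have "route G w (edge_point G w e t) \<bar>s - t\<bar> (edge_point G w e s)"
    using route_step1[of e t s] step.hyps by (simp add: abs_minus_commute)
  from route_trans[OF step.IH this] show ?case by (simp add: add.commute)
qed (rule route.refl)

lemma route_vertices:
  assumes "u \<in> verts G" "v \<in> verts G"
  shows "\<exists>l. route G w (Vertex u) l (Vertex v)"
proof -
  have "u \<rightarrow>\<^sup>*\<^bsub>with_proj (mk_symmetric G)\<^esub> v"
    using connected_graph assms
    unfolding Digraph_Component.connected_def strongly_connected_def by simp
  then have "(u, v) \<in> rtrancl_on (verts G) (parcs (mk_symmetric G))"
    by (simp add: reachable_def)
  then show ?thesis
  proof (induction rule: rtrancl_on_induct)
    case base
    then show ?case by (auto intro!: exI route.refl simp: gpoints_def)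
  next
    case (step a b)
    then obtain l e where l: "route G w (Vertex u) l (Vertex a)" and e: "e \<in> arcs G"
      and ab: "(a, b) = (tail G e, head G e) \<or> (a, b) = (head G e, tail G e)"
      by (auto simp: parcs_mk_symmetric)
    have r: "route G w (Vertex (tail G e)) (w e) (Vertex (head G e))"
      using route_step1[of e 0 "w e"] e weight_pos[OF e] by (simp add: edge_point_def)
    have "route G w (Vertex a) (w e) (Vertex b)" using ab r route_sym[OF r] by auto
    from route_trans[OF this l] show ?case by blast
  qed
qed

lemma route_to_vertex:
  assumes "x \<in> gpoints G w"
  shows "\<exists>l. \<exists>v\<in>verts G. route G w x l (Vertex v)"
proof (cases x)
  case (Vertex v)
  then show ?thesis using assms route.refl[OF assms] by (auto simp: gpoints_def)
next
  case (Interior e t)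
  then have e: "e \<in> arcs G" "0 < t" "t < w e" using assms by (auto simp: gpoints_def)
  have "route G w x t (Vertex (tail G e))"
    using route_step1[of e t 0] e Interior by (simp add: edge_point_def)
  then show ?thesis using e tail_in_verts by blast
qed

lemma route_exists:
  assumes "x \<in> gpoints G w" "y \<in> gpoints G w"
  shows "\<exists>l. route G w x l y"
proof -
  obtain l u where u: "u \<in> verts G" "route G w x l (Vertex u)"
    using route_to_vertex[OF assms(1)] by blast
  obtain m v where v: "v \<in> verts G" "route G w y m (Vertex v)"
    using route_to_vertex[OF assms(2)] by blast
  obtain n where "route G w (Vertex u) n (Vertex v)"
    using route_vertices u v by blast
  with u(2) route_sym[OF v(2)] show ?thesis by (meson route_trans)
qed

lemma route_separation:
  assumes "x \<in> gpoints G w" "y \<in> gpoints G w" "x \<noteq> y"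
  shows "\<exists>h. (\<forall>e\<in>arcs G. \<forall>s\<in>{0..w e}. \<forall>t\<in>{0..w e}.
      \<bar>h (edge_point G w e s) - h (edge_point G w e t)\<bar> \<le> \<bar>s - t\<bar>) \<and> h x \<noteq> (h y :: real)"
proof (cases x)
  case (Interior e0 t0)
  then have e0: "e0 \<in> arcs G" "0 < t0" "t0 < w e0" using assms by (auto simp: gpoints_def)
  define r where "r = min t0 (w e0 - t0)"
  define h where "h p = (case p of Vertex u \<Rightarrow> r
     | Interior e t \<Rightarrow> if e = e0 then min r \<bar>t - t0\<bar> else r)" for p :: "('v, 'e) gpoint"
  have hp: "h (edge_point G w e s) = (if e = e0 then min r \<bar>s - t0\<bar> else r)"
    if "s \<in> {0..w e}" for e s
    using that e0 by (auto simp: h_def edge_point_def r_def)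
  have "h x \<noteq> h y"
    using e0 assms(3) by (cases y) (auto simp: Interior h_def r_def min_def)
  moreover have "\<forall>e\<in>arcs G. \<forall>s\<in>{0..w e}. \<forall>t\<in>{0..w e}.
      \<bar>h (edge_point G w e s) - h (edge_point G w e t)\<bar> \<le> \<bar>s - t\<bar>"
    by (auto simp: hp)
  ultimately show ?thesis by blast
next
  case (Vertex v)
  define r where "r = Min (insert 1 (w ` arcs G))"
  have r: "0 < r" "\<And>e. e \<in> arcs G \<Longrightarrow> r \<le> w e"
    unfolding r_def using weight_pos by (auto intro: Min_le)
  define h where "h p = (case p of Vertex u \<Rightarrow> if u = v then 0 else r
     | Interior e t \<Rightarrow> min r (min (if tail G e = v then t else r)
                              (if head G e = v then w e - t else r)))" for p :: "('v, 'e) gpoint"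
  have hp: "h (edge_point G w e s) = min r (min (if tail G e = v then s else r)
                              (if head G e = v then w e - s else r))"
    if "s \<in> {0..w e}" "e \<in> arcs G" for e s
    using that r(1) r(2)[OF that(2)] weight_pos[OF that(2)] by (auto simp: h_def edge_point_def)
  have "h x \<noteq> h y"
    using r(1) assms(2,3) by (cases y) (auto simp: Vertex h_def gpoints_def min_def)
  moreover have "\<forall>e\<in>arcs G. \<forall>s\<in>{0..w e}. \<forall>t\<in>{0..w e}.
      \<bar>h (edge_point G w e s) - h (edge_point G w e t)\<bar> \<le> \<bar>s - t\<bar>"
    by (auto simp: hp)
  ultimately show ?thesis by blast
qed

lemma bdd_below_routes: "bdd_below {l. route G w x l y}"
  by (rule bdd_belowI[of _ 0]) (auto dest: route_nonneg)

lemma path_dist_le: "x \<in> gpoints G w \<Longrightarrow> y \<in> gpoints G w \<Longrightarrow> route G w x l y \<Longrightarrow> path_dist G w x y \<le> l"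
  by (auto simp: path_dist_def intro!: cInf_lower bdd_below_routes)

lemma path_dist_greatest:
  assumes "x \<in> gpoints G w" "y \<in> gpoints G w" "\<And>l. route G w x l y \<Longrightarrow> c \<le> l"
  shows "c \<le> path_dist G w x y"
  using assms route_exists[OF assms(1,2)] by (auto simp: path_dist_def intro!: cInf_greatest)

sublocale Metric_space "gpoints G w" "path_dist G w"
proof
  fix x y
  show "0 \<le> path_dist G w x y"
  proof (cases "x \<in> gpoints G w \<and> y \<in> gpoints G w")
    case True
    then show ?thesis by (intro path_dist_greatest) (auto dest: route_nonneg)
  qed (auto simp: path_dist_def)
  show "path_dist G w x y = path_dist G w y x"
    using route_sym by (auto simp: path_dist_def intro!: arg_cong[where f = Inf])
next
  fix x y assume xy: "x \<in> gpoints G w" "y \<in> gpoints G w"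
  show "path_dist G w x y = 0 \<longleftrightarrow> x = y"
  proof
    assume d: "path_dist G w x y = 0"
    show "x = y"
    proof (rule ccontr)
      assume "x \<noteq> y"
      then obtain h where h: "\<forall>e\<in>arcs G. \<forall>s\<in>{0..w e}. \<forall>t\<in>{0..w e}.
          \<bar>h (edge_point G w e s) - h (edge_point G w e t)\<bar> \<le> \<bar>s - t\<bar>" "h x \<noteq> (h y :: real)"
        using route_separation[OF xy] by blast
      have "\<bar>h x - h y\<bar> \<le> path_dist G w x y"
        by (rule path_dist_greatest[OF xy], rule route_lipschitz) (use h(1) in auto)
      with h(2) d show False by simp
    qed
  next
    assume "x = y"
    then have "path_dist G w x y \<le> 0" using path_dist_le[OF xy] route.refl[OF xy(1)] by simp
    moreover have "0 \<le> path_dist G w x y" by (rule path_dist_greatest[OF xy route_nonneg])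
    ultimately show "path_dist G w x y = 0" by simp
  qed
next
  fix x y z assume xyz: "x \<in> gpoints G w" "y \<in> gpoints G w" "z \<in> gpoints G w"
  have "path_dist G w x z - m \<le> path_dist G w x y" if "route G w y m z" for m
    by (rule path_dist_greatest[OF xyz(1,2)])
       (use path_dist_le[OF xyz(1,3)] route_trans[OF that] in fastforce)
  then have "path_dist G w x z - path_dist G w x y \<le> path_dist G w y z"
    by (intro path_dist_greatest[OF xyz(2,3)]) (simp add: algebra_simps)
  then show "path_dist G w x z \<le> path_dist G w x y + path_dist G w y z" by simp
qed

end

section \<open>Divisors and firings\<close>

type_synonym ('v, 'e) divisor = "('v, 'e) gpoint \<Rightarrow>\<^sub>0 int"

definition is_divisor ::
  "('v, 'e) pre_digraph \<Rightarrow> ('e \<Rightarrow> real) \<Rightarrow> ('v, 'e) divisor \<Rightarrow> bool" where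
  "is_divisor G w D \<longleftrightarrow> Poly_Mapping.keys D \<subseteq> gpoints G w"

definition effective_away ::
  "('v, 'e) pre_digraph \<Rightarrow> ('e \<Rightarrow> real) \<Rightarrow> ('v, 'e) gpoint \<Rightarrow> ('v, 'e) divisor \<Rightarrow> bool" where
  "effective_away G w q D \<longleftrightarrow> (\<forall>p\<in>gpoints G w. p \<noteq> q \<longrightarrow> 0 \<le> Poly_Mapping.lookup D p)"

text \<open>
  \<open>I\<close> is an open segment of length \<open>\<epsilon>\<close> with endpoints \<open>x\<close> and \<open>y\<close>. The segment may run through
  vertices of degree 2 of the underlying graph. Requiring the parametrisation to be isometric for
  the global path metric is no restriction for the segments of a firing: the function of the firing
  (0 on \<open>X\<close>, \<open>\<epsilon>\<close> on \<open>Y\<close>, of slope 1 on the segments) is 1-Lipschitz, so the distance between two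
  points of one segment is the distance measured inside that segment.
\<close>

definition open_segment_between ::
  "('v, 'e) pre_digraph \<Rightarrow> ('e \<Rightarrow> real) \<Rightarrow> real \<Rightarrow>
     ('v, 'e) gpoint \<Rightarrow> ('v, 'e) gpoint set \<Rightarrow> ('v, 'e) gpoint \<Rightarrow> bool" where
  "open_segment_between G w \<epsilon> x I y \<longleftrightarrow>
     (\<exists>\<gamma>. \<gamma> ` {0..\<epsilon>} \<subseteq> gpoints G w \<and>
          (\<forall>s\<in>{0..\<epsilon>}. \<forall>t\<in>{0..\<epsilon>}. path_dist G w (\<gamma> s) (\<gamma> t) = \<bar>s - t\<bar>) \<and>
          \<gamma> 0 = x \<and> \<gamma> \<epsilon> = y \<and> I = \<gamma> ` {0<..<\<epsilon>})"

text \<open>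
  The component \<open>fsegs\<close> lists the segments of the cut, each together with its endpoint in \<open>X\<close>
  (first) and in \<open>Y\<close> (last). In a firing it is determined by \<open>X\<close> and \<open>Y\<close>: the open segments are
  the connected components of the complement of \<open>X \<union> Y\<close>.
\<close>

record ('v, 'e) firing =
  fX :: "('v, 'e) gpoint set"
  fY :: "('v, 'e) gpoint set"
  flength :: real
  fsegs :: "(('v, 'e) gpoint \<times> ('v, 'e) gpoint set \<times> ('v, 'e) gpoint) set"

definition firing_towards ::
  "('v, 'e) pre_digraph \<Rightarrow> ('e \<Rightarrow> real) \<Rightarrow> ('v, 'e) gpoint \<Rightarrow> ('v, 'e) firing \<Rightarrow> bool" where
  "firing_towards G w q f \<longleftrightarrow>
     fX f \<noteq> {} \<and> closedin (gtopology G w) (fX f) \<and> connectedin (gtopology G w) (fX f) \<and>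
     fY f \<noteq> {} \<and> closedin (gtopology G w) (fY f) \<and> connectedin (gtopology G w) (fY f) \<and>
     fX f \<inter> fY f = {} \<and> q \<in> fX f \<and> 0 < flength f \<and>
     finite (fsegs f) \<and>
     gpoints G w - (fX f \<union> fY f) = (\<Union>(x, I, y)\<in>fsegs f. I) \<and>
     disjoint_family_on (\<lambda>(x, I, y). I) (fsegs f) \<and>
     (\<forall>(x, I, y)\<in>fsegs f. x \<in> fX f \<and> y \<in> fY f \<and> open_segment_between G w (flength f) x I y)"

definition firing_divisor :: "('v, 'e) firing \<Rightarrow> ('v, 'e) divisor" where
  "firing_divisor f =
     (\<Sum>(x, I, y)\<in>fsegs f. Poly_Mapping.single y 1 - Poly_Mapping.single x 1)"

definition legal_firing ::
  "('v, 'e) pre_digraph \<Rightarrow> ('e \<Rightarrow> real) \<Rightarrow> ('v, 'e) gpoint \<Rightarrow>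
     ('v, 'e) divisor \<Rightarrow> ('v, 'e) firing \<Rightarrow> bool" where
  "legal_firing G w q D f \<longleftrightarrow>
     firing_towards G w q f \<and> effective_away G w q D \<and>
     effective_away G w q (D - firing_divisor f)"

definition maximal_legal_firing ::
  "('v, 'e) pre_digraph \<Rightarrow> ('e \<Rightarrow> real) \<Rightarrow> ('v, 'e) gpoint \<Rightarrow>
     ('v, 'e) divisor \<Rightarrow> ('v, 'e) firing \<Rightarrow> bool" where
  "maximal_legal_firing G w q D f \<longleftrightarrow>
     legal_firing G w q D f \<and>
     \<not> (\<exists>f'. legal_firing G w q D f' \<and> fY f' = fY f \<and> flength f < flength f')"

end

theory Submission
  imports Defs
begin

text \<open>
  Greedy reduction can imitate the subtractive Euclidean algorithm on an incommensurable pair.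
  On the complete bipartite graph with parts \<open>A\<^sub>0, A\<^sub>1, A\<^sub>2\<close> and \<open>B\<^sub>0, B\<^sub>1, B\<^sub>2, q\<close> put one chip
  on every edge. The chips on the three edges \<open>A\<^sub>i B\<^sub>i\<close> lie at distances \<open>0\<close>, \<open>b\<close> and \<open>a + b\<close> from
  \<open>A\<^sub>i\<close>, in cyclic order, where \<open>b / a\<close> is the golden ratio; all other chips lie in the middle of
  their edges. If \<open>A\<^sub>i\<close> is the vertex carrying a chip, fire \<open>A\<^sub>i\<close> together with the two
  vertices \<open>B\<^sub>j\<close>, \<open>j \<noteq> i\<close>. The firing stops after length \<open>b\<close>, when the second chip reaches its
  vertex, and the distances have become \<open>b\<close>, \<open>0\<close> and \<open>a\<close>: the same configuration, shifted cyclically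
  and scaled by \<open>a / b\<close>, because \<open>b = a + (b - a)\<close>. The lengths form a convergent geometric series, so
  if the edges are long enough no other chip ever reaches an end of its edge.
\<close>

section \<open>Segments of a firing\<close>

context metric_graph
begin

section \<open>Continuity, closedness and connectedness from Lipschitz bounds\<close>

lemma continuous_map_of_lipschitz:
  assumes "\<And>s. s \<in> T \<Longrightarrow> \<gamma> s \<in> gpoints G w"
    and "\<And>s t. s \<in> T \<Longrightarrow> t \<in> T \<Longrightarrow> path_dist G w (\<gamma> s) (\<gamma> t) \<le> \<bar>s - t :: real\<bar>"
  shows "continuous_map (top_of_set T) mtopology \<gamma>"
  unfolding continuous_map_to_metric
proof (intro ballI allI impI)
  fix x \<epsilon> :: real assume x: "x \<in> topspace (top_of_set T)" and "\<epsilon> > 0"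
  have "openin (top_of_set T) (T \<inter> ball x \<epsilon>)" by (simp add: openin_open_Int)
  moreover have "x \<in> T \<inter> ball x \<epsilon>" using x \<open>\<epsilon> > 0\<close> by simp
  moreover have "\<forall>y \<in> T \<inter> ball x \<epsilon>. \<gamma> y \<in> mball (\<gamma> x) \<epsilon>"
    using x assms(1) le_less_trans[OF assms(2)] by (auto simp: dist_real_def)
  ultimately show "\<exists>U. openin (top_of_set T) U \<and> x \<in> U \<and> (\<forall>y\<in>U. \<gamma> y \<in> mball (\<gamma> x) \<epsilon>)"
    by blast
qed

lemma closedin_lipschitz_level:
  assumes "\<And>x y. x \<in> gpoints G w \<Longrightarrow> y \<in> gpoints G w \<Longrightarrow> \<bar>h x - h y :: real\<bar> \<le> path_dist G w x y"
  shows "closedin mtopology {x \<in> gpoints G w. h x = c}"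
proof -
  have "continuous_map mtopology Met_TC.mtopology h"
    unfolding metric_continuous_map[OF Met_TC.Metric_space_axioms]
  proof (intro conjI ballI allI impI)
    fix a \<epsilon> assume "a \<in> gpoints G w" "0 < (\<epsilon>::real)"
    then show "\<exists>\<delta>>0. \<forall>x. x \<in> gpoints G w \<and> path_dist G w a x < \<delta> \<longrightarrow> dist (h a) (h x) < \<epsilon>"
      using assms by (intro exI[of _ \<epsilon>]) (auto simp: dist_real_def intro: le_less_trans)
  qed simp
  from closedin_continuous_map_preimage[OF this, of "{c}"] show ?thesis by simp
qed

lemma edge_lipschitz_imp_lipschitz:
  assumes "\<And>e s t. e \<in> arcs G \<Longrightarrow> s \<in> {0..w e} \<Longrightarrow> t \<in> {0..w e}
             \<Longrightarrow> \<bar>h (edge_point G w e s) - h (edge_point G w e t) :: real\<bar> \<le> \<bar>s - t\<bar>"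
    and "x \<in> gpoints G w" "y \<in> gpoints G w"
  shows "\<bar>h x - h y\<bar> \<le> path_dist G w x y"
  by (rule path_dist_greatest[OF assms(2,3)]) (rule route_lipschitz[OF assms(1)])

lemma edge_point_dist_le:
  assumes "e \<in> arcs G" "s \<in> {0..w e}" "t \<in> {0..w e}"
  shows "path_dist G w (edge_point G w e s) (edge_point G w e t) \<le> \<bar>s - t\<bar>"
  using path_dist_le[OF _ _ route_step1[OF assms]] assms(1) edge_point_mem by blast

lemma connectedin_edge_interval:
  assumes "e \<in> arcs G" "0 \<le> a" "b \<le> w e"
  shows "connectedin mtopology (edge_point G w e ` {a..b})"
proof (rule connectedin_continuous_map_image)
  show "continuous_map (top_of_set {a..b}) mtopology (edge_point G w e)"
    using assms by (intro continuous_map_of_lipschitz edge_point_mem edge_point_dist_le) auto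
  show "connectedin (top_of_set {a..b}) {a..b}"
    by (simp add: connectedin_subtopology)
qed

section \<open>Topology of the segments of an arbitrary firing\<close>

lemma firing_towardsD:
  assumes f: "firing_towards G w q f"
  shows "closedin mtopology (fX f)" "closedin mtopology (fY f)" "fX f \<inter> fY f = {}"
    and "finite (fsegs f)" "0 < flength f"
    and "gpoints G w - (fX f \<union> fY f) = (\<Union>\<sigma>\<in>fsegs f. fst (snd \<sigma>))"
    and "\<And>\<sigma> \<tau>. \<sigma> \<in> fsegs f \<Longrightarrow> \<tau> \<in> fsegs f \<Longrightarrow> \<sigma> \<noteq> \<tau> \<Longrightarrow> fst (snd \<sigma>) \<inter> fst (snd \<tau>) = {}"
    and "\<And>\<sigma>. \<sigma> \<in> fsegs f \<Longrightarrow> fst \<sigma> \<in> fX f" "\<And>\<sigma>. \<sigma> \<in> fsegs f \<Longrightarrow> snd (snd \<sigma>) \<in> fY f"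
  using f by (simp_all add: firing_towards_def case_prod_beta disjoint_family_on_def)

lemma firing_segmentE:
  assumes "firing_towards G w q f" "(x, I, y) \<in> fsegs f"
  obtains \<gamma> where "\<gamma> ` {0..flength f} \<subseteq> gpoints G w"
    "\<And>s t. s \<in> {0..flength f} \<Longrightarrow> t \<in> {0..flength f} \<Longrightarrow> path_dist G w (\<gamma> s) (\<gamma> t) = \<bar>s - t\<bar>"
    "\<gamma> 0 = x" "\<gamma> (flength f) = y" "I = \<gamma> ` {0<..<flength f}" "x \<in> fX f" "y \<in> fY f"
proof -
  have "\<forall>(x, I, y)\<in>fsegs f. x \<in> fX f \<and> y \<in> fY f \<and> open_segment_between G w (flength f) x I y"
    using assms(1) by (simp add: firing_towards_def)
  from bspec[OF this assms(2)]
  have xy: "x \<in> fX f" "y \<in> fY f" and "open_segment_between G w (flength f) x I y" by simp_all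
  then obtain \<gamma> where \<gamma>: "\<gamma> ` {0..flength f} \<subseteq> gpoints G w"
    "\<forall>s\<in>{0..flength f}. \<forall>t\<in>{0..flength f}. path_dist G w (\<gamma> s) (\<gamma> t) = \<bar>s - t\<bar>"
    "\<gamma> 0 = x" "\<gamma> (flength f) = y" "I = \<gamma> ` {0<..<flength f}"
    unfolding open_segment_between_def by blast
  show thesis by (rule that[OF \<gamma>(1) _ \<gamma>(3-5) xy]) (use \<gamma>(2) in simp)
qed

text \<open>A continuous image of a compact interval is compact, hence closed in a Hausdorff
  space.\<close>

lemma closedin_isometric_interval:
  assumes "\<gamma> ` {0..\<epsilon>} \<subseteq> gpoints G w"
    and "\<And>s t. s \<in> {0..\<epsilon>} \<Longrightarrow> t \<in> {0..\<epsilon>} \<Longrightarrow> path_dist G w (\<gamma> s) (\<gamma> t) = \<bar>s - t\<bar>"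
    and "0 \<le> a" "b \<le> \<epsilon>"
  shows "closedin mtopology (\<gamma> ` {a..b})"
proof -
  have "continuous_map (top_of_set {a..b}) mtopology \<gamma>"
    using assms by (intro continuous_map_of_lipschitz) (auto simp: image_subset_iff)
  then have "compactin mtopology (\<gamma> ` {a..b})"
    by (rule image_compactin[rotated]) (simp add: compactin_subtopology)
  then show ?thesis
    by (rule compactin_imp_closedin[OF Hausdorff_space_mtopology])
qed

text \<open>The complement of \<open>I\<close> is the union of \<open>X\<close>, \<open>Y\<close>
  and the other segments with their endpoints: finitely many closed sets.\<close>

lemma firing_segment_openin:
  assumes f: "firing_towards G w q f" and I: "(x, I, y) \<in> fsegs f"
  shows "openin mtopology I"
proof -
  \<comment> \<open>Adding the endpoints makes each segment closed without touching
    \<open>I\<close>, since the endpoints lie in \<open>X\<close> and \<open>Y\<close>.\<close>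
  define cl where "cl = (\<lambda>(x, I, y). insert x (insert y I) :: ('v, 'e) gpoint set)"
  define rest where "rest = fX f \<union> fY f \<union> (\<Union>\<sigma>\<in>fsegs f - {(x, I, y)}. cl \<sigma>)"
  have "closedin mtopology (cl \<sigma>)" if "\<sigma> \<in> fsegs f" for \<sigma>
  proof -
    obtain a J b where \<sigma>: "\<sigma> = (a, J, b)" by (cases \<sigma>)
    then have \<sigma>f: "(a, J, b) \<in> fsegs f" using that by simp
    obtain \<gamma> where \<gamma>: "\<gamma> ` {0..flength f} \<subseteq> gpoints G w"
      "\<And>s t. s \<in> {0..flength f} \<Longrightarrow> t \<in> {0..flength f} \<Longrightarrow> path_dist G w (\<gamma> s) (\<gamma> t) = \<bar>s - t\<bar>"
      "\<gamma> 0 = a" "\<gamma> (flength f) = b" "J = \<gamma> ` {0<..<flength f}"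
      using firing_segmentE[OF f \<sigma>f] by blast
    have "{0..flength f} = insert 0 (insert (flength f) {0<..<flength f})"
      using f by (auto simp: firing_towards_def)
    then have "cl \<sigma> = \<gamma> ` {0..flength f}" using \<gamma> by (auto simp: cl_def \<sigma>)
    then show ?thesis using closedin_isometric_interval[OF \<gamma>(1,2)] by simp
  qed
  moreover have "closedin mtopology (fX f)" "closedin mtopology (fY f)" "finite (fsegs f)"
    using firing_towardsD[OF f] by auto
  ultimately have "closedin mtopology rest"
    unfolding rest_def by (intro closedin_Un closedin_Union) auto
  moreover have "I = gpoints G w - rest"
  proof (intro equalityI subsetI)
    fix p assume p: "p \<in> I"
    have "p \<in> gpoints G w - (fX f \<union> fY f)"
      unfolding firing_towardsD(6)[OF f] using I p by force
    moreover have "p \<notin> cl \<sigma>" if "\<sigma> \<in> fsegs f - {(x, I, y)}" for \<sigma>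
    proof -
      obtain a J b where \<sigma>: "\<sigma> = (a, J, b)" by (cases \<sigma>)
      have "I \<inter> J = {}"
        using firing_towardsD(7)[OF f I, of \<sigma>] that unfolding \<sigma> by auto
      moreover have "a \<in> fX f" "b \<in> fY f" using firing_towardsD(8,9)[OF f, of \<sigma>] that unfolding \<sigma> by auto
      ultimately show ?thesis
        using p \<open>p \<in> gpoints G w - (fX f \<union> fY f)\<close> by (auto simp: cl_def \<sigma>)
    qed
    ultimately show "p \<in> gpoints G w - rest" by (auto simp: rest_def)
  next
    fix p assume p: "p \<in> gpoints G w - rest"
    then obtain a J b where \<sigma>: "(a, J, b) \<in> fsegs f" "p \<in> J"
      using firing_towardsD(6)[OF f] unfolding rest_def by force
    then have "p \<in> cl (a, J, b)" by (simp add: cl_def)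
    then have "(a, J, b) = (x, I, y)" using p \<sigma> by (auto simp: rest_def)
    then show "p \<in> I" using \<sigma> by simp
  qed
  ultimately show ?thesis by (simp add: openin_diff)
qed

text \<open>
  A connected set missing a point of every segment would be cut at these points into a part
  near \<open>X\<close> and a part near \<open>Y\<close>.
\<close>

lemma firing_segment_subset_connectedin:
  assumes f: "firing_towards G w q f" and C: "connectedin mtopology C"
    and X: "C \<inter> fX f \<noteq> {}" and Y: "C \<inter> fY f \<noteq> {}"
  shows "\<exists>(x, I, y)\<in>fsegs f. I \<subseteq> C"
proof (rule ccontr)
  assume "\<not> ?thesis"
  then have no: "\<And>\<sigma>. \<sigma> \<in> fsegs f \<Longrightarrow> \<not> fst (snd \<sigma>) \<subseteq> C" by force
  define P where "P \<sigma> \<gamma> u \<longleftrightarrow> \<gamma> ` {0..flength f} \<subseteq> gpoints G w \<and>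
     (\<forall>s\<in>{0..flength f}. \<forall>t\<in>{0..flength f}. path_dist G w (\<gamma> s) (\<gamma> t) = \<bar>s - t\<bar>) \<and>
     \<gamma> 0 \<in> fX f \<and> \<gamma> (flength f) \<in> fY f \<and> fst (snd \<sigma>) = \<gamma> ` {0<..<flength f} \<and>
     u \<in> {0<..<flength f} \<and> \<gamma> u \<notin> C"
    for \<sigma> :: "('v, 'e) gpoint \<times> ('v, 'e) gpoint set \<times> ('v, 'e) gpoint" and \<gamma> u
  have "\<exists>\<gamma> u. P \<sigma> \<gamma> u" if "\<sigma> \<in> fsegs f" for \<sigma>
  proof -
    obtain a J b where \<sigma>: "\<sigma> = (a, J, b)" by (cases \<sigma>)
    then have \<sigma>f: "(a, J, b) \<in> fsegs f" using that by simp
    obtain \<gamma> where \<gamma>: "\<gamma> ` {0..flength f} \<subseteq> gpoints G w"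
      "\<And>s t. s \<in> {0..flength f} \<Longrightarrow> t \<in> {0..flength f} \<Longrightarrow> path_dist G w (\<gamma> s) (\<gamma> t) = \<bar>s - t\<bar>"
      "\<gamma> 0 = a" "\<gamma> (flength f) = b" "J = \<gamma> ` {0<..<flength f}" "a \<in> fX f" "b \<in> fY f"
      using firing_segmentE[OF f \<sigma>f] by blast
    have "\<not> J \<subseteq> C" using no[OF \<sigma>f] by simp
    then obtain u where "u \<in> {0<..<flength f}" "\<gamma> u \<notin> C" unfolding \<gamma>(5) by blast
    then have "P \<sigma> \<gamma> u" using \<gamma> unfolding P_def \<sigma> by simp
    then show ?thesis by blast
  qed
  then obtain \<gamma> u where P: "\<And>\<sigma>. \<sigma> \<in> fsegs f \<Longrightarrow> P \<sigma> (\<gamma> \<sigma>) (u \<sigma>)"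
    by metis
  have \<gamma>: "\<gamma> \<sigma> ` {0..flength f} \<subseteq> gpoints G w"
    "\<And>s t. s \<in> {0..flength f} \<Longrightarrow> t \<in> {0..flength f}
        \<Longrightarrow> path_dist G w (\<gamma> \<sigma> s) (\<gamma> \<sigma> t) = \<bar>s - t\<bar>"
    "\<gamma> \<sigma> 0 \<in> fX f" "\<gamma> \<sigma> (flength f) \<in> fY f" "fst (snd \<sigma>) = \<gamma> \<sigma> ` {0<..<flength f}"
    "u \<sigma> \<in> {0<..<flength f}" "\<gamma> \<sigma> (u \<sigma>) \<notin> C" if "\<sigma> \<in> fsegs f" for \<sigma>
    using P[OF that] unfolding P_def by blast+
  \<comment> \<open>Every segment is split at its missed point. Both halves are closed and keep that
    point, so \<open>E1\<close> and \<open>E2\<close> are closed and overlap only outside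
    \<open>C\<close>.\<close>
  define E1 where "E1 = fX f \<union> (\<Union>\<sigma>\<in>fsegs f. \<gamma> \<sigma> ` {0..u \<sigma>})"
  define E2 where "E2 = fY f \<union> (\<Union>\<sigma>\<in>fsegs f. \<gamma> \<sigma> ` {u \<sigma>..flength f})"
  have fin: "finite (fsegs f)" and cl: "closedin mtopology (fX f)" "closedin mtopology (fY f)"
    and cover: "gpoints G w - (fX f \<union> fY f) = (\<Union>\<sigma>\<in>fsegs f. fst (snd \<sigma>))"
    and XY: "fX f \<inter> fY f = {}"
    and dis: "\<And>\<sigma> \<tau>. \<sigma> \<in> fsegs f \<Longrightarrow> \<tau> \<in> fsegs f \<Longrightarrow> \<sigma> \<noteq> \<tau> \<Longrightarrow> fst (snd \<sigma>) \<inter> fst (snd \<tau>) = {}"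
    using firing_towardsD[OF f] by auto
  have "closedin mtopology (\<gamma> \<sigma> ` {0..u \<sigma>})" "closedin mtopology (\<gamma> \<sigma> ` {u \<sigma>..flength f})"
    if "\<sigma> \<in> fsegs f" for \<sigma>
    using \<gamma>(6)[OF that] by (auto intro!: closedin_isometric_interval[OF \<gamma>(1,2)] that)
  then have "closedin mtopology E1" "closedin mtopology E2"
    unfolding E1_def E2_def using fin cl by (auto intro!: closedin_Un closedin_Union)
  moreover have "C \<subseteq> E1 \<union> E2"
  proof
    fix p assume "p \<in> C"
    then have "p \<in> gpoints G w" using connectedin_subset_topspace[OF C] by auto
    then have "p \<in> fX f \<or> p \<in> fY f \<or> (\<exists>\<sigma>\<in>fsegs f. p \<in> fst (snd \<sigma>))"
      using equalityD1[OF cover, THEN subsetD, of p] by simp blast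
    moreover have "fX f \<subseteq> E1" "fY f \<subseteq> E2" unfolding E1_def E2_def by simp_all
    moreover have "p \<in> E1 \<union> E2" if \<sigma>: "\<sigma> \<in> fsegs f" "p \<in> fst (snd \<sigma>)" for \<sigma>
    proof -
      obtain s where "p = \<gamma> \<sigma> s" "s \<in> {0<..<flength f}" using \<sigma>(2) \<gamma>(5)[OF \<sigma>(1)] by blast
      then show ?thesis unfolding E1_def E2_def using \<sigma>(1)
        by (cases "s \<le> u \<sigma>") force+
    qed
    ultimately show "p \<in> E1 \<union> E2" by blast
  qed
  moreover have "E1 \<inter> E2 \<inter> C = {}"
  proof -
    have seg: "\<gamma> \<sigma> s \<in> fst (snd \<sigma>)" "\<gamma> \<sigma> s \<notin> fX f" "\<gamma> \<sigma> s \<notin> fY f"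
      if "\<sigma> \<in> fsegs f" "s \<in> {0<..<flength f}" for \<sigma> s
    proof -
      show "\<gamma> \<sigma> s \<in> fst (snd \<sigma>)" using \<gamma>(5) that by simp
      then show "\<gamma> \<sigma> s \<notin> fX f" "\<gamma> \<sigma> s \<notin> fY f" using cover that(1) by blast+
    qed
    have low: "p \<in> fX f \<or> (\<exists>\<sigma>\<in>fsegs f. \<exists>s\<in>{0<..<flength f}. s \<le> u \<sigma> \<and> p = \<gamma> \<sigma> s)"
      if "p \<in> E1" for p
    proof -
      have "p \<in> fX f \<or> (\<exists>\<sigma>\<in>fsegs f. \<exists>s\<in>{0<..<flength f}. s \<le> u \<sigma> \<and> p = \<gamma> \<sigma> s)"
        if "\<sigma> \<in> fsegs f" "p = \<gamma> \<sigma> s" "s \<in> {0..u \<sigma>}" for \<sigma> s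
      proof (cases "s = 0")
        case True
        then show ?thesis using that(2) \<gamma>(3)[OF that(1)] by simp
      next
        case False
        then have "s \<in> {0<..<flength f}" "s \<le> u \<sigma>" using that(3) \<gamma>(6)[OF that(1)] by auto
        then show ?thesis using that(1,2) by blast
      qed
      then show ?thesis using that unfolding E1_def by blast
    qed
    have high: "p \<in> fY f \<or> (\<exists>\<sigma>\<in>fsegs f. \<exists>s\<in>{0<..<flength f}. u \<sigma> \<le> s \<and> p = \<gamma> \<sigma> s)"
      if "p \<in> E2" for p
    proof -
      have "p \<in> fY f \<or> (\<exists>\<sigma>\<in>fsegs f. \<exists>s\<in>{0<..<flength f}. u \<sigma> \<le> s \<and> p = \<gamma> \<sigma> s)"
        if "\<sigma> \<in> fsegs f" "p = \<gamma> \<sigma> s" "s \<in> {u \<sigma>..flength f}" for \<sigma> s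
      proof (cases "s = flength f")
        case True
        then show ?thesis using that(2) \<gamma>(4)[OF that(1)] by simp
      next
        case False
        then have "s \<in> {0<..<flength f}" "u \<sigma> \<le> s" using that(3) \<gamma>(6)[OF that(1)] by auto
        then show ?thesis using that(1,2) by blast
      qed
      then show ?thesis using that unfolding E2_def by blast
    qed
    \<comment> \<open>A common point must be interior to one segment, with parameters
      \<open>s \<le> u \<sigma> \<le> t\<close>; isometry forces \<open>s = t\<close>, which is the
      missed point.\<close>
    have False if p: "p \<in> E1" "p \<in> E2" "p \<in> C" for p
    proof -
      from low[OF p(1)] high[OF p(2)] XY seg
      obtain \<sigma> s \<tau> t where st: "\<sigma> \<in> fsegs f" "s \<in> {0<..<flength f}" "s \<le> u \<sigma>" "p = \<gamma> \<sigma> s"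
        "\<tau> \<in> fsegs f" "t \<in> {0<..<flength f}" "u \<tau> \<le> t" "p = \<gamma> \<tau> t" by (metis disjoint_iff)
      have "\<sigma> = \<tau>" using dis[of \<sigma> \<tau>] seg(1)[of \<sigma> s] seg(1)[of \<tau> t] st by auto
      have "path_dist G w (\<gamma> \<sigma> s) (\<gamma> \<sigma> t) = \<bar>s - t\<bar>"
        by (rule \<gamma>(2)[OF st(1)]) (use st(2,6) in auto)
      moreover have "\<gamma> \<sigma> s = p" "\<gamma> \<sigma> t = p" using st(4,8) \<open>\<sigma> = \<tau>\<close> by simp_all
      moreover have "path_dist G w p p = 0" using p(3) connectedin_subset_topspace[OF C] by auto
      ultimately have "s = t" by simp
      then have "s = u \<sigma>" using st(3,7) \<open>\<sigma> = \<tau>\<close> by simp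
      then show False using \<gamma>(7)[OF st(1)] st(4) p(3) by simp
    qed
    then show ?thesis by blast
  qed
  moreover have "E1 \<inter> C \<noteq> {}" "E2 \<inter> C \<noteq> {}" using X Y unfolding E1_def E2_def by auto
  ultimately show False using C unfolding connectedin_closedin by blast
qed

text \<open>A connected set meeting \<open>X\<close> and \<open>Y\<close> contains a whole open
  segment, in which distances come arbitrarily close to the length of the firing.\<close>

lemma firing_length_le:
  assumes f: "firing_towards G w q f" and C: "connectedin mtopology C"
    and X: "C \<inter> fX f \<noteq> {}" and Y: "C \<inter> fY f \<noteq> {}"
    and diam: "\<And>x y. x \<in> C \<Longrightarrow> y \<in> C \<Longrightarrow> path_dist G w x y \<le> l"
  shows "flength f \<le> l"
proof (rule ccontr)
  assume l: "\<not> flength f \<le> l"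
  have pos: "0 < flength f" using f by (simp add: firing_towards_def)
  obtain m where m: "m < flength f" "0 \<le> m" "l \<le> m" using l pos by (intro that[of "max l 0"]) auto
  \<comment> \<open>Then \<open>flength f - 2 * d\<close> equals
    \<open>(flength f + 2 * m) / 3\<close>, which exceeds \<open>m\<close> and hence
    \<open>l\<close>. Since \<open>m \<ge> 0\<close>, the parameters \<open>d\<close> and
    \<open>flength f - d\<close> stay inside the open interval.\<close>
  define d where "d = (flength f - m) / 3"
  have d: "0 < d" "d < flength f - d" "l < flength f - d - d"
    using m by (simp_all add: d_def field_simps)
  obtain x I y where I: "(x, I, y) \<in> fsegs f" "I \<subseteq> C"
    using firing_segment_subset_connectedin[OF f C X Y] by blast
  obtain \<gamma> where \<gamma>: "\<And>s t. s \<in> {0..flength f} \<Longrightarrow> t \<in> {0..flength f}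
      \<Longrightarrow> path_dist G w (\<gamma> s) (\<gamma> t) = \<bar>s - t\<bar>" "I = \<gamma> ` {0<..<flength f}"
    using firing_segmentE[OF f I(1)] by blast
  have "path_dist G w (\<gamma> d) (\<gamma> (flength f - d)) \<le> l"
    using I(2) d pos unfolding \<gamma>(2) by (intro diam) auto
  moreover have "path_dist G w (\<gamma> d) (\<gamma> (flength f - d)) = flength f - d - d"
    using d by (subst \<gamma>(1)) auto
  ultimately show False using d by simp
qed

text \<open>Moving along \<open>e\<close> gives the upper bound, a 1-Lipschitz function the lower
  one. Such points make up the small spheres that detect branching at \<open>v\<close>.\<close>

lemma path_dist_from_vertex:
  assumes v: "v \<in> verts G" and e: "e \<in> arcs G" "tail G e = v \<or> head G e = v"
    and \<delta>: "0 < \<delta>" "\<And>e. e \<in> arcs G \<Longrightarrow> 2 * \<delta> < w e"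
  shows "path_dist G w (Vertex v) (Interior e (if tail G e = v then \<delta> else w e - \<delta>)) = \<delta>"
    (is "path_dist G w ?v ?p = \<delta>")
proof -
  \<comment> \<open>The distance to \<open>v\<close>, truncated at \<open>\<delta>\<close>. The
    nested minima measure both ends of a loop at \<open>v\<close>; there
    \<open>2 * \<delta> < w e\<close> keeps the value \<open>\<delta>\<close> at the chosen
    point.\<close>
  define h where "h p = (case p of Vertex u \<Rightarrow> if u = v then 0 else \<delta>
     | Interior e t \<Rightarrow> min \<delta> (min (if tail G e = v then t else \<delta>)
                              (if head G e = v then w e - t else \<delta>)))" for p :: "('v, 'e) gpoint"
  have hp: "h (edge_point G w e s) = min \<delta> (min (if tail G e = v then s else \<delta>)
                              (if head G e = v then w e - s else \<delta>))"
    if "s \<in> {0..w e}" "e \<in> arcs G" for e s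
    using that \<delta>(1) \<delta>(2)[OF that(2)] by (auto simp: h_def edge_point_def)
  have lip: "\<bar>h (edge_point G w e s) - h (edge_point G w e t)\<bar> \<le> \<bar>s - t\<bar>"
    if "e \<in> arcs G" "s \<in> {0..w e}" "t \<in> {0..w e}" for e s t
    using that by (auto simp: hp)
  have p: "?p \<in> gpoints G w" "?v \<in> gpoints G w"
    using v e \<delta>(1) \<delta>(2)[OF e(1)] by (auto simp: gpoints_def)
  have "\<bar>h ?v - h ?p\<bar> \<le> path_dist G w ?v ?p"
    by (rule edge_lipschitz_imp_lipschitz[OF lip p(2,1)])
  moreover have "h ?v = 0" "h ?p = \<delta>" using e(2) \<delta>(1) \<delta>(2)[OF e(1)] by (auto simp: h_def)
  moreover have "path_dist G w ?v ?p \<le> \<delta>"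
  proof (cases "tail G e = v")
    case True
    then show ?thesis using edge_point_dist_le[OF e(1), of 0 \<delta>] \<delta>(1) \<delta>(2)[OF e(1)]
      by (simp add: edge_point_def)
  next
    case False
    then show ?thesis using edge_point_dist_le[OF e(1), of "w e" "w e - \<delta>"] \<delta>(1) \<delta>(2)[OF e(1)] e(2)
      by (simp add: edge_point_def)
  qed
  ultimately show ?thesis using \<delta>(1) by simp
qed

text \<open>
  Small spheres around a vertex of degree at least 3 have at least three points, while a point of
  an isometric open segment has only two neighbours at a given small distance.
\<close>

lemma branch_vertex_not_in_segment:
  assumes f: "firing_towards G w q f" and I: "(x, I, y) \<in> fsegs f"
    and v: "v \<in> verts G"
    and A: "A \<subseteq> arcs G" "card A = 3" "\<And>e. e \<in> A \<Longrightarrow> tail G e = v \<or> head G e = v"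
  shows "Vertex v \<notin> I"
proof
  assume vI: "Vertex v \<in> I"
  obtain r where r: "0 < r" "mball (Vertex v) r \<subseteq> I"
    using firing_segment_openin[OF f I] vI unfolding openin_mtopology by blast
  \<comment> \<open>The factor 3 leaves room for both \<open>\<delta> < r\<close> and
    \<open>2 * \<delta> < w e\<close>.\<close>
  define \<delta> where "\<delta> = Min (insert r (w ` arcs G)) / 3"
  have \<delta>: "0 < \<delta>" "\<delta> < r" "\<And>e. e \<in> arcs G \<Longrightarrow> 2 * \<delta> < w e"
  proof -
    have pos: "0 < Min (insert r (w ` arcs G))" using r weight_pos by simp
    then show "0 < \<delta>" by (simp add: \<delta>_def)
    have "Min (insert r (w ` arcs G)) \<le> r" by (rule Min_le) auto
    then show "\<delta> < r" unfolding \<delta>_def using pos r(1) by linarith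
    show "2 * \<delta> < w e" if "e \<in> arcs G" for e
    proof -
      have "Min (insert r (w ` arcs G)) \<le> w e" using that by (intro Min_le) auto
      then show ?thesis unfolding \<delta>_def using pos by linarith
    qed
  qed
  define p :: "'e \<Rightarrow> ('v, 'e) gpoint"
    where "p e = Interior e (if tail G e = v then \<delta> else w e - \<delta>)" for e
  have dp: "path_dist G w (Vertex v) (p e) = \<delta>" if "e \<in> A" for e
    unfolding p_def using path_dist_from_vertex[OF v _ _ \<delta>(1,3)] A that by blast
  have pI: "p e \<in> I" if e: "e \<in> A" for e
  proof -
    have "p e \<in> gpoints G w"
      using e A(1) \<delta>(1) \<delta>(3)[of e] by (auto simp: p_def gpoints_def)
    moreover have "Vertex v \<in> gpoints G w" using v by (simp add: gpoints_def)
    ultimately have "p e \<in> mball (Vertex v) r" using dp[OF e] \<delta>(2) by simp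
    then show ?thesis using r(2) by blast
  qed
  obtain \<gamma> where \<gamma>: "\<And>s t. s \<in> {0..flength f} \<Longrightarrow> t \<in> {0..flength f}
      \<Longrightarrow> path_dist G w (\<gamma> s) (\<gamma> t) = \<bar>s - t\<bar>" "I = \<gamma> ` {0<..<flength f}"
    using firing_segmentE[OF f I] by blast
  obtain s where s: "s \<in> {0<..<flength f}" "Vertex v = \<gamma> s" using vI \<gamma>(2) by auto
  have "p e \<in> \<gamma> ` {s - \<delta>, s + \<delta>}" if e: "e \<in> A" for e
  proof -
    obtain t where t: "t \<in> {0<..<flength f}" "p e = \<gamma> t" using pI[OF e] \<gamma>(2) by auto
    then have "\<bar>s - t\<bar> = \<delta>" using dp[OF e] \<gamma>(1)[of s t] s by auto
    then have "t = s - \<delta> \<or> t = s + \<delta>" by linarith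
    then show ?thesis using t(2) by auto
  qed
  then have "card (p ` A) \<le> card (\<gamma> ` {s - \<delta>, s + \<delta>})" by (intro card_mono) auto
  also have "\<dots> \<le> card {s - \<delta>, s + \<delta>}" by (rule card_image_le) simp
  also have "\<dots> \<le> 2" by (simp add: card_insert_if)
  finally have "card (p ` A) \<le> 2" .
  moreover have "card (p ` A) = 3" using A(2) by (subst card_image) (auto simp: inj_on_def p_def)
  ultimately show False by simp
qed

end

section \<open>Firing a set of vertices with one chip on every edge\<close>

text \<open>Reachability under this symmetric relation expresses connectedness of the induced
  subgraph, both for the whole graph and for the two sides of a cut.\<close>

definition inner_adjacency :: "('v, 'e) pre_digraph \<Rightarrow> 'v set \<Rightarrow> 'v rel" where
  "inner_adjacency G T = {(u, v). u \<in> T \<and> v \<in> T \<and>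
     (\<exists>e\<in>arcs G. (u, v) = (tail G e, head G e) \<or> (u, v) = (head G e, tail G e))}"

text \<open>Adjacency is symmetric, so any two vertices are joined through the root
  \<open>r\<close>.\<close>

lemma connected_if_inner_adjacency:
  assumes "r \<in> verts G" "\<And>v. v \<in> verts G \<Longrightarrow> (r, v) \<in> (inner_adjacency G (verts G))\<^sup>*"
  shows "Digraph_Component.connected G"
proof -
  let ?H = "with_proj (mk_symmetric G)"
  have sub: "inner_adjacency G (verts G) \<subseteq> parcs (mk_symmetric G)"
    by (auto simp: inner_adjacency_def parcs_mk_symmetric)
  have from_root: "(r, v) \<in> rtrancl_on (verts G) (parcs (mk_symmetric G))" if "v \<in> verts G" for v
    using assms(2)[OF that]
  proof (induction rule: rtrancl_induct)
    case base
    then show ?case using assms(1) by simp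
  next
    case (step x y)
    from step.IH show ?case
    proof (rule rtrancl_on_into_rtrancl_on)
      show "(x, y) \<in> parcs (mk_symmetric G)" using step.hyps(2) sub by blast
      show "y \<in> verts G" using step.hyps(2) by (simp add: inner_adjacency_def)
    qed
  qed
  have "sym (rtrancl_on (verts G) (parcs (mk_symmetric G)))"
    by (rule rtrancl_on_sym) (auto simp: parcs_mk_symmetric sym_def)
  then have "(u, v) \<in> rtrancl_on (verts G) (parcs (mk_symmetric G))"
    if "u \<in> verts G" "v \<in> verts G" for u v
    using rtrancl_on_trans from_root[OF that(1)] from_root[OF that(2)] by (metis symD)
  then show ?thesis
    using assms(1) unfolding Digraph_Component.connected_def strongly_connected_def
    by (auto simp: reachable_def)
qed

context metric_graph
begin

text \<open>Chips of different arcs may meet at a vertex, where their coefficients add. The position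
  vector \<open>p\<close> is therefore the state to be tracked, and the divisor only its
  image.\<close>

definition edge_chips :: "('e \<Rightarrow> real) \<Rightarrow> ('v, 'e) divisor" where
  "edge_chips p = (\<Sum>e\<in>arcs G. Poly_Mapping.single (edge_point G w e (p e)) 1)"

lemma effective_edge_chips: "effective_away G w q (edge_chips p)"
  by (simp add: effective_away_def edge_chips_def lookup_sum lookup_single sum_nonneg)

lemma is_divisor_edge_chips: "is_divisor G w (edge_chips p)"
proof -
  have "Poly_Mapping.keys (edge_chips p)
      \<subseteq> (\<Union>e\<in>arcs G. Poly_Mapping.keys (Poly_Mapping.single (edge_point G w e (p e)) (1 :: int)))"
    unfolding edge_chips_def by (rule keys_sum)
  also have "\<dots> \<subseteq> gpoints G w" using edge_point_mem by auto
  finally show ?thesis by (simp add: is_divisor_def)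
qed

end

text \<open>\<open>S\<close> becomes the set of vertices in \<open>Y\<close>. On an arc with exactly
  one end in \<open>S\<close>, the cut segment is the interval swept by the chip; the range
  assumptions keep it within that closed edge.\<close>

locale chip_cut = metric_graph G w
  for G :: "('v, 'e) pre_digraph" (structure) and w :: "'e \<Rightarrow> real" +
  fixes S :: "'v set" and p :: "'e \<Rightarrow> real" and \<epsilon> :: real
  assumes eps_pos: "0 < \<epsilon>" and S_sub: "S \<subseteq> verts G"
    and p_range: "e \<in> arcs G \<Longrightarrow> p e \<in> {0..w e}"
    and moved_range: "e \<in> arcs G \<Longrightarrow>
      p e + \<epsilon> * (of_bool (tail G e \<in> S) - of_bool (head G e \<in> S)) \<in> {0..w e}"
begin

definition dir :: "'e \<Rightarrow> real" where
  "dir e = of_bool (tail G e \<in> S) - of_bool (head G e \<in> S)"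

definition moved :: "'e \<Rightarrow> real" where
  "moved e = p e + \<epsilon> * dir e"

definition cut_arcs :: "'e set" where
  "cut_arcs = {e \<in> arcs G. tail G e \<in> S \<longleftrightarrow> head G e \<notin> S}"

text \<open>The piecewise affine function of the firing. With \<open>X\<close> and \<open>Y\<close>
  as its level sets, one Lipschitz bound yields both their closedness and the isometry of the
  segments.\<close>

definition height :: "('v, 'e) gpoint \<Rightarrow> real" where
  "height x = (case x of Vertex v \<Rightarrow> if v \<in> S then \<epsilon> else 0
     | Interior e t \<Rightarrow> if e \<in> cut_arcs then max 0 (min \<epsilon> (dir e * (moved e - t)))
                      else if tail G e \<in> S then \<epsilon> else 0)"

text \<open>Parametrised by height: it runs from the new position in \<open>X\<close> back to the
  old one in \<open>Y\<close>, against the motion of the chip.\<close>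

definition chip_path :: "'e \<Rightarrow> real \<Rightarrow> ('v, 'e) gpoint" where
  "chip_path e s = edge_point G w e (moved e - dir e * s)"

definition cut_firing :: "('v, 'e) firing" where
  "cut_firing = \<lparr>fX = {x \<in> gpoints G w. height x = 0}, fY = {x \<in> gpoints G w. height x = \<epsilon>},
     flength = \<epsilon>, fsegs = (\<lambda>e. (chip_path e 0, chip_path e ` {0<..<\<epsilon>}, chip_path e \<epsilon>)) ` cut_arcs\<rparr>"

section \<open>The height function and the segments swept by the chips\<close>

lemma chip_ranges: "e \<in> arcs G \<Longrightarrow> 0 \<le> p e \<and> p e \<le> w e \<and> 0 \<le> moved e \<and> moved e \<le> w e"
  using p_range[of e] moved_range[of e] by (simp add: moved_def dir_def)

lemma dir_cases:
  assumes "e \<in> cut_arcs"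
  shows "dir e = 1 \<and> tail G e \<in> S \<and> head G e \<notin> S \<or> dir e = -1 \<and> tail G e \<notin> S \<and> head G e \<in> S"
  using assms by (auto simp: cut_arcs_def dir_def)

text \<open>Vertex values and interior formula agree at the ends: as \<open>p e\<close> and
  \<open>moved e\<close> lie in \<open>{0..w e}\<close>, clipping returns \<open>\<epsilon>\<close>
  at the end in \<open>S\<close> and 0 at the other.\<close>

lemma height_edge_point:
  assumes "e \<in> arcs G" "t \<in> {0..w e}"
  shows "height (edge_point G w e t) =
     (if e \<in> cut_arcs then max 0 (min \<epsilon> (dir e * (moved e - t))) else if tail G e \<in> S then \<epsilon> else 0)"
proof (cases "e \<in> cut_arcs")
  case True
  then show ?thesis
    using assms chip_ranges[OF assms(1)] eps_pos dir_cases[OF True]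
    by (auto simp: height_def edge_point_def moved_def)
next
  case False
  then show ?thesis using assms by (auto simp: height_def edge_point_def cut_arcs_def)
qed

lemma path_range:
  assumes "e \<in> cut_arcs" "s \<in> {0..\<epsilon>}"
  shows "moved e - dir e * s \<in> {0..w e}"
proof -
  have "e \<in> arcs G" using assms(1) by (simp add: cut_arcs_def)
  from dir_cases[OF assms(1)] chip_ranges[OF this] assms(2) show ?thesis
    by (auto simp: moved_def)
qed

lemma path_Interior:
  assumes "e \<in> cut_arcs" "s \<in> {0<..<\<epsilon>}"
  shows "chip_path e s = Interior e (moved e - dir e * s)"
proof -
  have "e \<in> arcs G" using assms(1) by (simp add: cut_arcs_def)
  from dir_cases[OF assms(1)] chip_ranges[OF this] assms(2) show ?thesis
    by (auto simp: moved_def chip_path_def edge_point_def)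
qed

lemma height_path:
  assumes "e \<in> cut_arcs" "s \<in> {0..\<epsilon>}"
  shows "height (chip_path e s) = s"
proof -
  have "e \<in> arcs G" using assms(1) by (simp add: cut_arcs_def)
  from height_edge_point[OF this path_range[OF assms]] assms dir_cases[OF assms(1)] show ?thesis
    by (auto simp: chip_path_def)
qed

lemma path_mem: "e \<in> cut_arcs \<Longrightarrow> chip_path e s \<in> gpoints G w"
  unfolding chip_path_def by (rule edge_point_mem) (simp add: cut_arcs_def)

lemma height_lipschitz:
  assumes "x \<in> gpoints G w" "y \<in> gpoints G w"
  shows "\<bar>height x - height y\<bar> \<le> path_dist G w x y"
proof (rule edge_lipschitz_imp_lipschitz[OF _ assms])
  fix e s t assume e: "e \<in> arcs G" "s \<in> {0..w e}" "t \<in> {0..w e}"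
  show "\<bar>height (edge_point G w e s) - height (edge_point G w e t)\<bar> \<le> \<bar>s - t\<bar>"
  proof (cases "e \<in> cut_arcs")
    case True
    from dir_cases[OF True] show ?thesis
      unfolding height_edge_point[OF e(1,2)] height_edge_point[OF e(1,3)] by auto
  next
    case False
    then show ?thesis unfolding height_edge_point[OF e(1,2)] height_edge_point[OF e(1,3)] by simp
  qed
qed

lemma height_bounds: "0 \<le> height x" "height x \<le> \<epsilon>"
  using eps_pos by (auto simp: height_def split: gpoint.split)

lemma height_strictly_between:
  assumes "x \<in> gpoints G w" "0 < height x" "height x < \<epsilon>"
  shows "\<exists>e\<in>cut_arcs. \<exists>s\<in>{0<..<\<epsilon>}. x = chip_path e s"
proof (cases x)
  case (Vertex v)
  then show ?thesis using assms by (auto simp: height_def split: if_splits)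
next
  case (Interior e t)
  then have e: "e \<in> cut_arcs" using assms by (auto simp: height_def split: if_splits)
  define s where "s = dir e * (moved e - t)"
  have s: "s \<in> {0<..<\<epsilon>}" using assms(2,3) e Interior by (auto simp: height_def s_def)
  have "moved e - dir e * s = t" using dir_cases[OF e] by (auto simp: s_def)
  then have "x = chip_path e s" using path_Interior[OF e s] Interior by simp
  then show ?thesis using e s by blast
qed

text \<open>The edge itself gives the upper bound. The lower bound holds because
  \<open>height\<close> is 1-Lipschitz and recovers the parameter.\<close>

lemma path_isometric:
  assumes "e \<in> cut_arcs" "s \<in> {0..\<epsilon>}" "t \<in> {0..\<epsilon>}"
  shows "path_dist G w (chip_path e s) (chip_path e t) = \<bar>s - t\<bar>"
proof (rule antisym)
  have e: "e \<in> arcs G" using assms(1) by (simp add: cut_arcs_def)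
  have "path_dist G w (chip_path e s) (chip_path e t) \<le> \<bar>(moved e - dir e * s) - (moved e - dir e * t)\<bar>"
    unfolding chip_path_def by (intro edge_point_dist_le e path_range assms)
  also have "\<dots> = \<bar>s - t\<bar>" using dir_cases[OF assms(1)] by auto
  finally show "path_dist G w (chip_path e s) (chip_path e t) \<le> \<bar>s - t\<bar>" .
  have "\<bar>height (chip_path e s) - height (chip_path e t)\<bar> \<le> path_dist G w (chip_path e s) (chip_path e t)"
    by (intro height_lipschitz path_mem assms)
  then show "\<bar>s - t\<bar> \<le> path_dist G w (chip_path e s) (chip_path e t)"
    using assms by (simp add: height_path)
qed

text \<open>The midpoint of a segment is an \<open>Interior\<close> point and so names its edge.
  Injectivity turns the sum over \<open>fsegs\<close> into a sum over arcs.\<close>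

lemma inj_on_segment: "inj_on (\<lambda>e. (chip_path e 0, chip_path e ` {0<..<\<epsilon>}, chip_path e \<epsilon>)) cut_arcs"
proof (rule inj_onI)
  fix d e assume de: "d \<in> cut_arcs" "e \<in> cut_arcs" and
    "(chip_path d 0, chip_path d ` {0<..<\<epsilon>}, chip_path d \<epsilon>) = (chip_path e 0, chip_path e ` {0<..<\<epsilon>}, chip_path e \<epsilon>)"
  moreover have half: "\<epsilon> / 2 \<in> {0<..<\<epsilon>}" using eps_pos by simp
  ultimately have "chip_path d (\<epsilon> / 2) \<in> chip_path e ` {0<..<\<epsilon>}" by auto
  then obtain s where "s \<in> {0<..<\<epsilon>}" "chip_path d (\<epsilon> / 2) = chip_path e s" by blast
  then show "d = e" using path_Interior[OF de(1) half] path_Interior[OF de(2)] by simp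
qed

text \<open>Each point of the level set is joined within it, along its own edge, to a vertex of
  \<open>T\<close>; vertices of \<open>T\<close> are joined through whole edges at the same
  level.\<close>

lemma connectedin_level:
  assumes c: "c = 0 \<or> c = \<epsilon>"
    and T: "T = {v \<in> verts G. height (Vertex v) = c}"
    and r: "r \<in> T" "\<And>v. v \<in> T \<Longrightarrow> (r, v) \<in> (inner_adjacency G T)\<^sup>*"
  shows "connectedin mtopology {x \<in> gpoints G w. height x = c}" (is "connectedin _ ?L")
proof -
  define linked where
    "linked x y \<longleftrightarrow> (\<exists>C. connectedin mtopology C \<and> C \<subseteq> ?L \<and> x \<in> C \<and> y \<in> C)" for x y
  have linked_trans: "linked x z" if xyz: "linked x y" "linked y z" for x y z
  proof -
    obtain C D where "connectedin mtopology C" "C \<subseteq> ?L" "x \<in> C" "y \<in> C"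
      "connectedin mtopology D" "D \<subseteq> ?L" "y \<in> D" "z \<in> D"
      using xyz unfolding linked_def by blast
    then show ?thesis
      unfolding linked_def by (intro exI[of _ "C \<union> D"]) (auto intro!: connectedin_Un)
  qed
  have linked_interval: "linked (edge_point G w e s) (edge_point G w e t)"
    if e: "e \<in> arcs G" "a \<in> {0..w e}" "b \<in> {0..w e}" "s \<in> {a..b}" "t \<in> {a..b}"
      and c: "\<And>u. u \<in> {a..b} \<Longrightarrow> height (edge_point G w e u) = c" for e a b s t
    unfolding linked_def
  proof (intro exI[of _ "edge_point G w e ` {a..b}"] conjI)
    show "connectedin mtopology (edge_point G w e ` {a..b})"
      using e by (intro connectedin_edge_interval) auto
  qed (use e c edge_point_mem in auto)
  have ends: "edge_point G w e 0 = Vertex (tail G e)" "edge_point G w e (w e) = Vertex (head G e)"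
    if "e \<in> arcs G" for e
    using weight_pos[OF that] by (auto simp: edge_point_def)
  have linked_inner: "linked (edge_point G w e s) (edge_point G w e t)"
    if "e \<in> arcs G" "e \<notin> cut_arcs" "height (Vertex (tail G e)) = c" "s \<in> {0..w e}" "t \<in> {0..w e}" for e s t
    using that by (intro linked_interval[of _ 0 "w e"])
      (auto simp: height_edge_point, auto simp: height_def split: if_splits)
  have linked_sym: "linked x y" if "linked y x" for x y using that unfolding linked_def by blast
  have vertex: "linked (Vertex r) (Vertex v)" if "v \<in> T" for v
    using r(2)[OF that]
  proof (induction rule: rtrancl_induct)
    case base
    have "Vertex r \<in> ?L" using r(1) unfolding T by (simp add: gpoints_def)
    then show ?case unfolding linked_def by (intro exI[of _ "{Vertex r}"]) auto
  next
    case (step x y)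
    then obtain e where e: "e \<in> arcs G" "tail G e \<in> T" "head G e \<in> T"
      and xy: "(x, y) = (tail G e, head G e) \<or> (x, y) = (head G e, tail G e)"
      by (auto simp: inner_adjacency_def)
    \<comment> \<open>Ends of equal height exclude a cut arc, so the whole edge stays at level
      \<open>c\<close>.\<close>
    have "e \<notin> cut_arcs" using e(2,3) eps_pos unfolding T by (auto simp: height_def cut_arcs_def split: if_splits)
    then have "linked (Vertex (tail G e)) (Vertex (head G e))"
      using linked_inner[of e 0 "w e"] e weight_pos[OF e(1)] ends[OF e(1)] unfolding T by simp
    then have "linked (Vertex x) (Vertex y)" using xy linked_sym by auto
    then show ?case using linked_trans step.IH by blast
  qed
  have to_vertex: "\<exists>v\<in>T. linked (Vertex v) x" if x: "x \<in> ?L" for x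
  proof (cases x)
    case (Vertex v)
    then have "v \<in> T" using x unfolding T by (auto simp: gpoints_def)
    then show ?thesis using Vertex x unfolding linked_def
      by (intro bexI[of _ v] exI[of _ "{x}"]) auto
  next
    case (Interior e t)
    then have e: "e \<in> arcs G" "0 < t" "t < w e" using x by (auto simp: gpoints_def)
    have xe: "x = edge_point G w e t" using e Interior by (simp add: edge_point_def)
    have hx: "height (edge_point G w e t) = c" using x xe by simp
    show ?thesis
    \<comment> \<open>Height is monotone along every edge, hence constant between \<open>x\<close>
      and an end of level \<open>c\<close>.\<close>
    proof (cases "height (Vertex (tail G e)) = c")
      case True
      have "linked (edge_point G w e 0) (edge_point G w e t)"
      proof (rule linked_interval[of _ 0 t])
        fix u assume u: "u \<in> {0..t}"
        show "height (edge_point G w e u) = c"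
        proof (cases "e \<in> cut_arcs")
          case cut: True
          then show ?thesis
            using dir_cases[OF cut] hx True u e c eps_pos
            by (auto simp: height_edge_point height_def[of "Vertex _"] split: if_splits)
        next
          case False
          then show ?thesis using hx u e by (auto simp: height_edge_point)
        qed
      qed (use e in auto)
      moreover have "tail G e \<in> T" using True e(1) unfolding T by simp
      ultimately show ?thesis using ends[OF e(1)] xe by (intro bexI[of _ "tail G e"]) auto
    next
      case False
      \<comment> \<open>An edge that is not cut has constant height. On a cut arc the ends have
        heights 0 and \<open>\<epsilon>\<close>, so the head has level \<open>c\<close>.\<close>
      have cut: "e \<in> cut_arcs" using False hx e
        by (auto simp: height_edge_point height_def[of "Vertex _"] split: if_splits)
      have "linked (edge_point G w e (w e)) (edge_point G w e t)"
      proof (rule linked_interval[of _ t "w e"])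
        fix u assume u: "u \<in> {t..w e}"
        show "height (edge_point G w e u) = c"
          using cut dir_cases[OF cut] hx False u e c eps_pos
          by (auto simp: height_edge_point height_def[of "Vertex _"] split: if_splits)
      qed (use e in auto)
      moreover have "head G e \<in> T"
        using cut False e(1) c unfolding T by (auto simp: cut_arcs_def height_def split: if_splits)
      ultimately show ?thesis using ends[OF e(1)] xe by (intro bexI[of _ "head G e"]) auto
    qed
  qed
  let ?\<C> = "{C. connectedin mtopology C \<and> C \<subseteq> ?L \<and> Vertex r \<in> C}"
  have "?L \<subseteq> \<Union>?\<C>"
  proof
    fix x assume "x \<in> ?L"
    then obtain v where "v \<in> T" "linked (Vertex v) x" using to_vertex by blast
    then have "linked (Vertex r) x" using vertex linked_trans by blast
    then show "x \<in> \<Union>?\<C>" unfolding linked_def by blast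
  qed
  then have "?L = \<Union>?\<C>" by blast
  moreover have "connectedin mtopology (\<Union>?\<C>)" by (rule connectedin_Union) auto
  ultimately show ?thesis by simp
qed

text \<open>Reachability inside each vertex set makes the two level sets connected; the cut segments
  are exactly the points of intermediate height.\<close>

lemma firing_towards_cut_firing:
  assumes q: "q \<in> verts G - S"
    and X: "\<And>v. v \<in> verts G - S \<Longrightarrow> (q, v) \<in> (inner_adjacency G (verts G - S))\<^sup>*"
    and Y: "r \<in> S" "\<And>v. v \<in> S \<Longrightarrow> (r, v) \<in> (inner_adjacency G S)\<^sup>*"
  shows "firing_towards G w (Vertex q) cut_firing"
  unfolding firing_towards_def
proof (intro conjI)
  have low: "verts G - S = {v \<in> verts G. height (Vertex v) = 0}"
    and high: "S = {v \<in> verts G. height (Vertex v) = \<epsilon>}"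
    using eps_pos S_sub by (auto simp: height_def)
  show "closedin mtopology (fX cut_firing)" "closedin mtopology (fY cut_firing)"
    by (simp_all add: cut_firing_def closedin_lipschitz_level height_lipschitz)
  show "connectedin mtopology (fX cut_firing)"
    using connectedin_level[OF _ low q X] by (simp add: cut_firing_def)
  show "connectedin mtopology (fY cut_firing)"
    using connectedin_level[OF _ high Y] by (simp add: cut_firing_def)
  show qX: "Vertex q \<in> fX cut_firing"
    using q by (simp add: cut_firing_def height_def gpoints_def)
  then show "fX cut_firing \<noteq> {}" by blast
  have "Vertex r \<in> fY cut_firing"
    using Y(1) S_sub by (auto simp: cut_firing_def height_def gpoints_def)
  then show "fY cut_firing \<noteq> {}" by blast
  show "fX cut_firing \<inter> fY cut_firing = {}" "0 < flength cut_firing"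
    using eps_pos by (auto simp: cut_firing_def)
  show "finite (fsegs cut_firing)" by (simp add: cut_firing_def cut_arcs_def)
  have "gpoints G w - (fX cut_firing \<union> fY cut_firing) = {x \<in> gpoints G w. 0 < height x \<and> height x < \<epsilon>}"
    using height_bounds by (auto simp: cut_firing_def less_le)
  also have "\<dots> = (\<Union>e\<in>cut_arcs. chip_path e ` {0<..<\<epsilon>})"
    using height_strictly_between path_mem by (force simp: height_path)
  finally show "gpoints G w - (fX cut_firing \<union> fY cut_firing) = (\<Union>(x, I, y)\<in>fsegs cut_firing. I)"
    by (simp add: cut_firing_def)
  show "disjoint_family_on (\<lambda>(x, I, y). I) (fsegs cut_firing)"
    unfolding disjoint_family_on_def cut_firing_def by (auto simp: path_Interior)
  show "\<forall>(x, I, y)\<in>fsegs cut_firing.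
    x \<in> fX cut_firing \<and> y \<in> fY cut_firing \<and> open_segment_between G w (flength cut_firing) x I y"
  proof -
    have "open_segment_between G w \<epsilon> (chip_path e 0) (chip_path e ` {0<..<\<epsilon>}) (chip_path e \<epsilon>)" if "e \<in> cut_arcs" for e
      unfolding open_segment_between_def
      using that path_isometric path_mem by (intro exI[of _ "chip_path e"]) auto
    then show ?thesis using eps_pos path_mem by (auto simp: cut_firing_def height_path)
  qed
qed

text \<open>The two ends of a cut segment are the old and the new position of its chip, so the
  firing acts as a translation of the position vector.\<close>

lemma edge_chips_minus_cut_firing: "edge_chips p - firing_divisor cut_firing = edge_chips moved"
proof -
  let ?s = "\<lambda>q e. Poly_Mapping.single (edge_point G w e (q e)) (1 :: int)"
  have "firing_divisor cut_firing =
      (\<Sum>e\<in>cut_arcs. Poly_Mapping.single (chip_path e \<epsilon>) 1 - Poly_Mapping.single (chip_path e 0) 1)"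
    by (simp add: firing_divisor_def cut_firing_def sum.reindex[OF inj_on_segment])
  also have "\<dots> = (\<Sum>e\<in>cut_arcs. ?s p e - ?s moved e)"
    by (simp add: chip_path_def moved_def algebra_simps)
  \<comment> \<open>Off the cut \<open>dir e\<close> is 0, so the added terms vanish.\<close>
  also have "\<dots> = (\<Sum>e\<in>arcs G. ?s p e - ?s moved e)"
    by (rule sum.mono_neutral_left) (auto simp: cut_arcs_def moved_def dir_def)
  finally show ?thesis by (simp add: edge_chips_def sum_subtractf)
qed

text \<open>
  A longer firing of the same set would push the chip of \<open>e\<close> through the branch vertex which it
  has reached.
\<close>

lemma maximal_cut_firing:
  assumes f: "firing_towards G w q cut_firing"
    and e: "e \<in> arcs G" "tail G e \<notin> S" "head G e \<in> S" "moved e = 0"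
    and A: "A \<subseteq> arcs G" "card A = 3" "\<And>a. a \<in> A \<Longrightarrow> tail G a = tail G e \<or> head G a = tail G e"
  shows "maximal_legal_firing G w q (edge_chips p) cut_firing"
proof -
  have False if g: "firing_towards G w q g" "fY g = fY cut_firing" "flength cut_firing < flength g" for g
  proof -
    let ?v = "tail G e"
    have v: "?v \<in> verts G" "Vertex ?v \<in> gpoints G w" using e(1) by (auto simp: gpoints_def)
    have "dir e = -1" "e \<in> cut_arcs" using e by (auto simp: dir_def cut_arcs_def)
    then have eps: "p e = \<epsilon>" "\<epsilon> \<le> w e" using e(4) chip_ranges[OF e(1)] by (auto simp: moved_def)
    \<comment> \<open>This stretch joins the vertex to the old chip position, a point of
      \<open>Y\<close>. Its diameter is at most \<open>\<epsilon>\<close>, so a longer firing cannot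
      have the vertex in \<open>X\<close>.\<close>
    let ?C = "edge_point G w e ` {0..\<epsilon>}"
    have vC: "Vertex ?v \<in> ?C" using eps_pos by (intro image_eqI[of _ _ 0]) (auto simp: edge_point_def)
    have "chip_path e \<epsilon> = edge_point G w e \<epsilon>" using \<open>dir e = -1\<close> e(4) by (simp add: chip_path_def)
    then have yC: "edge_point G w e \<epsilon> \<in> ?C \<inter> fY g"
      using g(2) \<open>e \<in> cut_arcs\<close> eps_pos height_path[of e \<epsilon>] edge_point_mem[OF e(1)]
      by (simp add: cut_firing_def)
    have "Vertex ?v \<notin> fX g"
    proof
      assume "Vertex ?v \<in> fX g"
      then have "flength g \<le> \<epsilon>"
      proof (intro firing_length_le[OF g(1), of ?C])
        show "connectedin mtopology ?C" using e(1) eps(2) by (intro connectedin_edge_interval) auto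
        fix x y assume "x \<in> ?C" "y \<in> ?C"
        then obtain s t where st: "x = edge_point G w e s" "y = edge_point G w e t"
          "s \<in> {0..\<epsilon>}" "t \<in> {0..\<epsilon>}" by blast
        then have "path_dist G w x y \<le> \<bar>s - t\<bar>"
          using edge_point_dist_le[OF e(1), of s t] eps(2) by auto
        then show "path_dist G w x y \<le> \<epsilon>" using st(3,4) by auto
      qed (use vC yC in auto)
      then show False using g(3) by (simp add: cut_firing_def)
    qed
    moreover have "Vertex ?v \<notin> fY g" using g(2) e(2) eps_pos by (simp add: cut_firing_def height_def)
    ultimately have "Vertex ?v \<in> (\<Union>\<sigma>\<in>fsegs g. fst (snd \<sigma>))"
      using firing_towardsD(6)[OF g(1)] v(2) by blast
    then obtain x I y where "(x, I, y) \<in> fsegs g" "Vertex ?v \<in> I" by force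
    then show False using branch_vertex_not_in_segment[OF g(1) _ v(1) A] by blast
  qed
  then show ?thesis
    using f effective_edge_chips edge_chips_minus_cut_firing
    unfolding maximal_legal_firing_def legal_firing_def by metis
qed

end

section \<open>The complete bipartite graph and the golden ratio\<close>

text \<open>The inverse golden ratio. At stage \<open>k\<close> the Euclidean pair is
  \<open>b = lam ^ k\<close>, \<open>a = lam ^ Suc k\<close>, and the firing has length
  \<open>b\<close>.\<close>

definition lam :: real where
  "lam = (sqrt 5 - 1) / 2"

lemma lam_bounds: "0 < lam" "lam < 2 / 3"
proof -
  have "sqrt 1 < sqrt 5" by (simp only: real_sqrt_less_iff)
  then show "0 < lam" by (simp add: lam_def)
  have "sqrt 5 < 7 / 3" by (rule real_less_lsqrt) (simp_all add: power2_eq_square)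
  then show "lam < 2 / 3" by (simp add: lam_def)
qed

text \<open>The subtractive Euclidean step: removing \<open>a\<close> from \<open>b\<close> leaves
  the next power.\<close>

lemma lam_power: "lam ^ Suc k + lam ^ Suc (Suc k) = lam ^ k"
proof -
  have "lam + lam * lam = 1" by (simp add: lam_def field_simps)
  then have "lam ^ k * (lam + lam * lam) = lam ^ k" by simp
  then show ?thesis by (simp add: algebra_simps)
qed

text \<open>
  The parts are \<open>{0, 1, 2}\<close> and \<open>{3, 4, 5, 6}\<close>; the arc \<open>4 * i + j\<close> joins \<open>i\<close> to \<open>3 + j\<close>, so the
  arcs \<open>0, 5, 10\<close> form the matching that carries the Euclidean algorithm.
\<close>

definition K34 :: "(nat, nat) pre_digraph" where
  "K34 = \<lparr>verts = {..<7}, arcs = {..<12}, tail = (\<lambda>e. e div 4), head = (\<lambda>e. 3 + e mod 4)\<rparr>"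

lemma K34_simps [simp]:
  "verts K34 = {..<7}" "arcs K34 = {..<12}" "tail K34 e = e div 4" "head K34 e = 3 + e mod 4"
  by (simp_all add: K34_def)

text \<open>Here \<open>A\<^sub>i\<close> is \<open>i\<close>, \<open>B\<^sub>j\<close> is
  \<open>3 + j\<close> and \<open>q\<close> is 6; at stage \<open>k\<close> the matching chip at its
  vertex is the one of index \<open>k mod 3\<close>.\<close>

definition fired :: "nat \<Rightarrow> nat set" where
  "fired k = insert (k mod 3) ({3, 4, 5} - {3 + k mod 3})"

text \<open>The start has \<open>b = 1\<close> and \<open>a = lam\<close>; the value 3 is the
  midpoint of an edge of length 6.\<close>

primrec pos :: "nat \<Rightarrow> nat \<Rightarrow> real" where
  "pos 0 e = (if e = 0 then 0 else if e = 5 then 1 else if e = 10 then 1 + lam else 3)"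
| "pos (Suc k) e = pos k e + lam ^ k * (of_bool (e div 4 \<in> fired k) - of_bool (3 + e mod 4 \<in> fired k))"

section \<open>Positions of the chips during the reduction\<close>

lemma mod_3_cases:
  fixes k :: nat
  obtains "k mod 3 = 0" "Suc k mod 3 = 1" "Suc (Suc k) mod 3 = 2"
    | "k mod 3 = 1" "Suc k mod 3 = 2" "Suc (Suc k) mod 3 = 0"
    | "k mod 3 = 2" "Suc k mod 3 = 0" "Suc (Suc k) mod 3 = 1"
proof -
  have "k mod 3 = 0 \<or> k mod 3 = 1 \<or> k mod 3 = 2" by linarith
  then show thesis using that by (auto simp: mod_Suc)
qed

text \<open>The chip at 0 advances to \<open>lam ^ k\<close> and the other two retreat by
  \<open>lam ^ k\<close>, to 0 and \<open>lam ^ Suc k\<close>; by \<open>lam_power\<close> this is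
  the same pattern for \<open>Suc k\<close>.\<close>

lemma pos_matching:
  "pos k (5 * (k mod 3)) = 0 \<and> pos k (5 * (Suc k mod 3)) = lam ^ k \<and>
   pos k (5 * (Suc (Suc k) mod 3)) = lam ^ k + lam ^ Suc k"
proof (induction k)
  case (Suc k)
  have "Suc (Suc (Suc k)) mod 3 = k mod 3" by presburger
  then show ?case
    using Suc.IH lam_power[of k] by (cases k rule: mod_3_cases) (simp_all add: fired_def)
qed simp

text \<open>As \<open>lam < 2 / 3\<close>, a step of at most \<open>lam ^ k\<close> is bounded by
  \<open>3 * (lam ^ k - lam ^ Suc k)\<close>, and these bounds telescope.\<close>

lemma pos_off_matching:
  assumes "e \<noteq> 0" "e \<noteq> 5" "e \<noteq> 10"
  shows "\<bar>pos k e - 3\<bar> \<le> 3 * (1 - lam ^ k)"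
proof (induction k)
  case (Suc k)
  have "\<bar>pos (Suc k) e - pos k e\<bar> \<le> lam ^ k"
    using lam_bounds(1) by (simp add: abs_mult)
  moreover have "lam ^ k * lam \<le> lam ^ k * (2 / 3)"
    using lam_bounds by (intro mult_left_mono) auto
  ultimately show ?case using Suc.IH by (simp add: algebra_simps)
qed (use assms in simp)

lemma pos_range:
  assumes "e < 12"
  shows "pos k e \<in> {0..6}"
proof (cases "e = 0 \<or> e = 5 \<or> e = 10")
  case True
  have "0 < lam ^ k" "lam ^ k \<le> 1" "0 < lam ^ Suc k" "lam ^ Suc k \<le> 1"
    using lam_bounds by (simp_all add: power_le_one del: power_Suc)
  moreover have "pos k e = 0 \<or> pos k e = lam ^ k \<or> pos k e = lam ^ k + lam ^ Suc k"
    using pos_matching[of k] True by (cases k rule: mod_3_cases) auto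
  ultimately show ?thesis by auto
next
  case False
  then have "\<bar>pos k e - 3\<bar> \<le> 3 * (1 - lam ^ k)" using pos_off_matching by blast
  moreover have "0 < lam ^ k" using lam_bounds by simp
  ultimately show ?thesis by auto
qed

section \<open>Connectivity of the example and validity of its firings\<close>

lemma fin_digraph_K34: "fin_digraph K34"
  by unfold_locales auto

lemma K34_adjacent:
  assumes "i < 3" "j < 4" "i \<in> T" "3 + j \<in> T"
  shows "(i, 3 + j) \<in> inner_adjacency K34 T" "(3 + j, i) \<in> inner_adjacency K34 T"
proof -
  have "4 * i + j < 12" "(4 * i + j) div 4 = i" "(4 * i + j) mod 4 = j" using assms(1,2) by auto
  then obtain e where e: "e \<in> arcs K34" "tail K34 e = i" "head K34 e = 3 + j"
    by (intro that[of "4 * i + j"]) simp_all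
  show "(i, 3 + j) \<in> inner_adjacency K34 T" "(3 + j, i) \<in> inner_adjacency K34 T"
    unfolding inner_adjacency_def mem_Collect_eq case_prod_conv
    by (intro conjI bexI[of _ e] assms(3,4) e(1), simp add: e(2,3) del: K34_simps)+
qed

text \<open>A vertex set meeting both parts of a complete bipartite graph is connected:
  \<open>i\<close> is adjacent to all its members in the other part.\<close>

lemma K34_reachable_from_3:
  assumes T: "T \<subseteq> {..<7}" and S: "i < 3" "i \<in> T" and j: "j < 4" "3 + j \<in> T" and v: "v \<in> T"
  shows "(3 + j, v) \<in> (inner_adjacency K34 T)\<^sup>*"
proof -
  let ?R = "inner_adjacency K34 T"
  show ?thesis
  proof (cases "v < 3")
    case True
    then show ?thesis using K34_adjacent(2)[of v j T] j v by blast
  next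
    case False
    then obtain l where l: "v = 3 + l" "l < 4" using T v by (auto simp: not_less le_iff_add)
    have "(3 + j, i) \<in> ?R" "(i, v) \<in> ?R"
      using K34_adjacent[of i _ T] S j v l by auto
    then show ?thesis by (meson rtrancl.simps)
  qed
qed

interpretation K34: metric_graph K34 "\<lambda>_. 6"
proof -
  have "Digraph_Component.connected K34"
    using K34_reachable_from_3[of "verts K34" 0 0]
    by (intro connected_if_inner_adjacency[of 3]) simp_all
  then show "metric_graph K34 (\<lambda>_. 6)"
    using fin_digraph_K34 by (simp add: metric_graph_def metric_graph_axioms_def)
qed

interpretation K34: chip_cut K34 "\<lambda>_. 6" "fired k" "pos k" "lam ^ k" for k
proof
  show "0 < lam ^ k" using lam_bounds by simp
  show "fired k \<subseteq> verts K34" by (auto simp: fired_def)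
  fix e assume "e \<in> arcs K34"
  then have "e < 12" by simp
  then show "pos k e \<in> {0..6}" by (rule pos_range)
  \<comment> \<open>The moved positions at stage \<open>k\<close> are the positions at stage
    \<open>Suc k\<close>.\<close>
  from pos_range[OF \<open>e < 12\<close>, of "Suc k"]
  show "pos k e + lam ^ k * (of_bool (tail K34 e \<in> fired k) - of_bool (head K34 e \<in> fired k)) \<in> {0..6}"
    by simp
qed

lemma moved_pos: "K34.moved k = pos (Suc k)"
  by (rule ext) (simp add: K34.moved_def K34.dir_def)

lemma firing_towards_K34: "firing_towards K34 (\<lambda>_. 6) (Vertex 6) (K34.cut_firing k)"
proof (rule K34.firing_towards_cut_firing)
  \<comment> \<open>This index serves twice: the vertex \<open>?j\<close> stays unfired and connects
    the side of \<open>q\<close>, while \<open>3 + ?j\<close> is fired and serves as root of the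
    other side.\<close>
  let ?j = "Suc k mod 3"
  show "6 \<in> verts K34 - fired k" by (auto simp: fired_def)
  show "(6, v) \<in> (inner_adjacency K34 (verts K34 - fired k))\<^sup>*" if "v \<in> verts K34 - fired k" for v
    using K34_reachable_from_3[of "verts K34 - fired k" "?j" 3 v] that
    by (cases k rule: mod_3_cases) (auto simp: fired_def)
  show "3 + ?j \<in> fired k" by (cases k rule: mod_3_cases) (auto simp: fired_def)
  show "(3 + ?j, v) \<in> (inner_adjacency K34 (fired k))\<^sup>*" if "v \<in> fired k" for v
    by (rule K34_reachable_from_3[of _ "k mod 3"], insert that)
      (cases k rule: mod_3_cases; auto simp: fired_def)+
qed

text \<open>The chip at distance \<open>lam ^ k\<close> on the matching arc of index
  \<open>Suc k mod 3\<close> reaches the tail of that arc, a vertex of degree 4, which blocks any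
  longer firing.\<close>

lemma maximal_K34:
  "maximal_legal_firing K34 (\<lambda>_. 6) (Vertex 6) (K34.edge_chips (pos k)) (K34.cut_firing k)"
proof (rule K34.maximal_cut_firing[OF firing_towards_K34])
  let ?i = "Suc k mod 3"
  \<comment> \<open>Three of the four arcs at the vertex \<open>?i\<close>.\<close>
  let ?A = "{4 * ?i, 4 * ?i + 1, 4 * ?i + 2}"
  have i: "?i < 3" by simp
  show "5 * ?i \<in> arcs K34" using i by simp
  show "tail K34 (5 * ?i) \<notin> fired k" "head K34 (5 * ?i) \<in> fired k"
    by (cases k rule: mod_3_cases; simp add: fired_def)+
  show "K34.moved k (5 * ?i) = 0" using pos_matching[of "Suc k"] by (simp only: moved_pos)
  show "?A \<subseteq> arcs K34" using i by auto
  show "card ?A = 3" by simp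
  show "tail K34 a = tail K34 (5 * ?i) \<or> head K34 a = tail K34 (5 * ?i)" if "a \<in> ?A" for a
    using that by (cases k rule: mod_3_cases) auto
qed

theorem theorem2:
  shows "\<exists>(G :: (nat, nat) pre_digraph) (w :: nat \<Rightarrow> real) (q :: (nat, nat) gpoint)
      (D :: (nat, nat) divisor).
    metric_graph G w \<and> q \<in> gpoints G w \<and> is_divisor G w D \<and> effective_away G w q D \<and>
    (\<exists>(Ds :: nat \<Rightarrow> (nat, nat) divisor) (fs :: nat \<Rightarrow> (nat, nat) firing).
       Ds 0 = D \<and>
       (\<forall>i\<ge>1. maximal_legal_firing G w q (Ds (i - 1)) (fs (i - 1)) \<and>
               Ds i = Ds (i - 1) - firing_divisor (fs (i - 1))))"
proof (intro exI[of _ K34] exI[of _ "\<lambda>_. 6"] exI[of _ "Vertex 6"] exI[of _ "K34.edge_chips (pos 0)"]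
    exI[of _ "\<lambda>k. K34.edge_chips (pos k)"] exI[of _ K34.cut_firing] conjI allI impI)
  show "metric_graph K34 (\<lambda>_. 6)" by (rule K34.metric_graph_axioms)
  show "Vertex 6 \<in> gpoints K34 (\<lambda>_. 6)" by (simp add: gpoints_def)
  show "is_divisor K34 (\<lambda>_. 6) (K34.edge_chips (pos 0))" by (rule K34.is_divisor_edge_chips)
  show "effective_away K34 (\<lambda>_. 6) (Vertex 6) (K34.edge_chips (pos 0))"
    by (rule K34.effective_edge_chips)
  fix i :: nat assume i: "1 \<le> i"
  show "maximal_legal_firing K34 (\<lambda>_. 6) (Vertex 6) (K34.edge_chips (pos (i - 1)))
      (K34.cut_firing (i - 1))"
    by (rule maximal_K34)
  show "K34.edge_chips (pos i) =
      K34.edge_chips (pos (i - 1)) - firing_divisor (K34.cut_firing (i - 1))"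
    using i by (simp add: K34.edge_chips_minus_cut_firing moved_pos)
qed simp

end
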